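(* Let $g^\theta$ be an individually rational randomized matching mechanism for $n$ workers and $m$ firms, and let preference profiles $\succ$ be drawn from a given probability distribution on the set $P$ of preference profiles. Then $g^\theta$ is ordinal strategy-proof up to zero-measure events (i.e. with probability one over the profile $\succ$, no agent $i$ with any $\succ_i$-utility can increase its expected utility at $\succ$ by a misreport $\succ_i'$) if and only if its expected regret satisfies $\mathit{RGT}(g^\theta)=0$.
   Context: Setting. $W$ is a set of $n$ workers, $F$ a set of $m$ firms ($n,m\ge1$), $\overline F=F\cup\{\bot\}$, $\overline W=W\cup\{\bot\}$, where $\bot$ denotes being unmatched. Each worker $w$ has a strict preference order $\succ_w$ over $\overline F$, each firm $f$ a strict preference order $\succ_f$ over $\overline W$; agents ranked below $\bot$ are unacceptable. $P$ is the (finite) set of all preference profiles $\succ$; $\succ_{-i}$ is the profile without agent $i$. We write $a\succeq_i b$ for $a\succ_i b$ or $a=b$. Mechanism. A randomized matching mechanism $g^\theta$ (with $\theta$ a parameter vector) maps each profile $\succ\in P$ to a distribution on matchings with marginal match probabilities $g^\theta_{wf}(\succ)\in[0,1]$, $w\in W,f\in F$, where $\sum_{f\in F}g^\theta_{wf}(\succ)\le1$ for every $w$ and $\sum_{w\in W}g^\theta_{wf}(\succ)\le1$ for every $f$ (the remaining probability is that of being matched to $\bot$). It is individually rational: $g^\theta_{wf}(\succ)=0$ whenever $\bot\succ_w f$ or $\bot\succ_f w$. Ordinal strategy-proofness. A function $u_w:\overline F\to\mathbb R$ is a $\succ_w$-utility if $u_w(f)>u_w(f')\iff f\succ_w f'$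 for all $f,f'\in\overline F$; similarly for firms. Ordinal strategy-proofness at the profile $\succ$ requires, for all agents $i\in W\cup F$, all $\succ_i$-utilities $u_i$ and all reports $\succ_i'$, that $\mathbf E_{\mu\sim g^\theta(\succ_i,\succ_{-i})}[u_i(\mu(i))]\ge\mathbf E_{\mu\sim g^\theta(\succ_i',\succ_{-i})}[u_i(\mu(i))]$, where $\mu(i)$ is the partner of $i$ (or $\bot$) in matching $\mu$. Ordinal strategy-proofness of $g^\theta$ means this holds at all profiles; "up to zero-measure events" means it holds at $\succ$ with probability one. Regret. For worker $w$ and report $\succ_w'$ let $\Delta_{wf}(g^\theta,\succ_w',\succ)=g^\theta_{wf}(\succ_w',\succ_{-w})-g^\theta_{wf}(\succ_w,\succ_{-w})$; for firm $f$ and report $\succ_f'$ let $\Delta_{wf}(g^\theta,\succ_f',\succ)=g^\theta_{wf}(\succ_f',\succ_{-f})-g^\theta_{wf}(\succ_f,\succ_{-f})$. Then $$\mathrm{regret}_w(g^\theta,\succ)=\max_{\succ_w'}\Big(\max_{f'\in F:\,f'\succ_w\bot}\ \sum_{f\in F:\,f\succeq_w f'}\Delta_{wf}(g^\theta,\succ_w',\succ)\Big),$$ $$\mathrm{regret}_f(g^\theta,\succ)=\max_{\succ_f'}\Big(\max_{w'\in W:\,w'\succ_f\bot}\ \sum_{w\in W:\,w\succeq_f w'}\Delta_{wf}(g^\theta,\succ_f',\succ)\Big),$$ where the outer maxima range over all preference orders (including the true one) the agent may report, and the inner maximum over an empty set is taken to be $0$. The average regret at $\succ$ is $\mathit{regret}(g^\theta,\succ)=\frac12\big(\frac1m\sum_{w\in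 W}\mathrm{regret}_w(g^\theta,\succ)+\frac1n\sum_{f\in F}\mathrm{regret}_f(g^\theta,\succ)\big)$, and $\mathit{RGT}(g^\theta)=\mathbb E_\succ[\mathit{regret}(g^\theta,\succ)]$, the expectation being over the given distribution on $P$. *)

theory Defs
  imports "HOL-Probability.Probability"
begin

text \<open>
  The workers are the elements of a finite type \<open>'w\<close> and the firms those of a finite type \<open>'f\<close>, so
  \<open>n = CARD('w)\<close> and \<open>m = CARD('f)\<close> are arbitrary positive numbers. Being unmatched is \<^const>\<open>None\<close>:
  workers rank \<open>'f option\<close> and firms rank \<open>'w option\<close>.
\<close>

typedef 'a pref = "{r :: ('a \<times> 'a) set. strict_linear_order r}"
  morphisms pref_rel Abs_pref
proof -
  obtain r :: "('a \<times> 'a) set" where "well_order_on UNIV r"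
    using well_order_on by blast
  then have "strict_linear_order (r - Id)"
    by (simp add: well_order_on_def strict_linear_order_on_diff_Id)
  then show ?thesis by blast
qed

instance pref :: (finite) finite
proof
  have "inj (pref_rel :: 'a pref \<Rightarrow> _)"
    by (simp add: inj_on_def pref_rel_inject)
  then show "finite (UNIV :: 'a pref set)"
    by (intro finite_imageD[of pref_rel]) simp_all
qed

definition prefers :: "'a \<Rightarrow> 'a pref \<Rightarrow> 'a \<Rightarrow> bool"  ("(_ \<succ>\<^bsub>_\<^esub> _)" [51, 0, 51] 50)
  where "a \<succ>\<^bsub>r\<^esub> b \<longleftrightarrow> (a, b) \<in> pref_rel r"

definition weakly_prefers :: "'a \<Rightarrow> 'a pref \<Rightarrow> 'a \<Rightarrow> bool"  ("(_ \<succeq>\<^bsub>_\<^esub> _)" [51, 0, 51] 50)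
  where "a \<succeq>\<^bsub>r\<^esub> b \<longleftrightarrow> a \<succ>\<^bsub>r\<^esub> b \<or> a = b"

text \<open>A profile is the pair of the workers' and the firms' preference orders.\<close>

type_synonym ('w, 'f) profile = "('w \<Rightarrow> 'f option pref) \<times> ('f \<Rightarrow> 'w option pref)"

definition worker_report ::
    "('w, 'f) profile \<Rightarrow> 'w \<Rightarrow> 'f option pref \<Rightarrow> ('w, 'f) profile"
  where "worker_report P w r = ((fst P)(w := r), snd P)"

definition firm_report ::
    "('w, 'f) profile \<Rightarrow> 'f \<Rightarrow> 'w option pref \<Rightarrow> ('w, 'f) profile"
  where "firm_report P f r = (fst P, (snd P)(f := r))"

typedef ('w, 'f) matching = "{M :: ('w \<times> 'f) set. single_valued M \<and> single_valued (M\<inverse>)}"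
  morphisms pairs Abs_matching
  by (rule exI[of _ "{}"]) simp

instance matching :: (finite, finite) finite
proof
  have "inj (pairs :: ('a, 'b) matching \<Rightarrow> _)"
    by (simp add: inj_on_def pairs_inject)
  then show "finite (UNIV :: ('a, 'b) matching set)"
    by (intro finite_imageD[of pairs]) simp_all
qed

lemma matched_firm_unique: "(w, f) \<in> pairs \<mu> \<Longrightarrow> (w, f') \<in> pairs \<mu> \<Longrightarrow> f = f'"
  using pairs[of \<mu>] by (auto dest: single_valuedD)

lemma matched_worker_unique: "(w, f) \<in> pairs \<mu> \<Longrightarrow> (w', f) \<in> pairs \<mu> \<Longrightarrow> w = w'"
  using pairs[of \<mu>] by (auto dest: single_valuedD)

definition worker_partner :: "('w, 'f) matching \<Rightarrow> 'w \<Rightarrow> 'f option"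
  where "worker_partner \<mu> w =
    (if \<exists>f. (w, f) \<in> pairs \<mu> then Some (THE f. (w, f) \<in> pairs \<mu>) else None)"

definition firm_partner :: "('w, 'f) matching \<Rightarrow> 'f \<Rightarrow> 'w option"
  where "firm_partner \<mu> f =
    (if \<exists>w. (w, f) \<in> pairs \<mu> then Some (THE w. (w, f) \<in> pairs \<mu>) else None)"

type_synonym ('w, 'f) mechanism = "('w, 'f) profile \<Rightarrow> ('w, 'f) matching pmf"

definition match_prob :: "('w, 'f) mechanism \<Rightarrow> ('w, 'f) profile \<Rightarrow> 'w \<Rightarrow> 'f \<Rightarrow> real"
  where "match_prob g P w f = measure_pmf.prob (g P) {\<mu>. (w, f) \<in> pairs \<mu>}"

lemma sum_match_prob_worker_le_1:
  fixes g :: "('w :: finite, 'f :: finite) mechanism"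
  shows "(\<Sum>f\<in>UNIV. match_prob g P w f) \<le> 1"
proof -
  have "disjoint_family (\<lambda>f. {\<mu> :: ('w, 'f) matching. (w, f) \<in> pairs \<mu>})"
    by (auto simp: disjoint_family_on_def dest: matched_firm_unique)
  then have "(\<Sum>f\<in>UNIV. match_prob g P w f) =
      measure_pmf.prob (g P) (\<Union>f\<in>UNIV. {\<mu>. (w, f) \<in> pairs \<mu>})"
    unfolding match_prob_def by (intro measure_pmf.finite_measure_finite_Union[symmetric]) auto
  then show ?thesis by simp
qed

lemma sum_match_prob_firm_le_1:
  fixes g :: "('w :: finite, 'f :: finite) mechanism"
  shows "(\<Sum>w\<in>UNIV. match_prob g P w f) \<le> 1"
proof -
  have "disjoint_family (\<lambda>w. {\<mu> :: ('w, 'f) matching. (w, f) \<in> pairs \<mu>})"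
    by (auto simp: disjoint_family_on_def dest: matched_worker_unique)
  then have "(\<Sum>w\<in>UNIV. match_prob g P w f) =
      measure_pmf.prob (g P) (\<Union>w\<in>UNIV. {\<mu>. (w, f) \<in> pairs \<mu>})"
    unfolding match_prob_def by (intro measure_pmf.finite_measure_finite_Union[symmetric]) auto
  then show ?thesis by simp
qed

definition individually_rational :: "('w, 'f) mechanism \<Rightarrow> bool"
  where "individually_rational g \<longleftrightarrow>
    (\<forall>P w f. None \<succ>\<^bsub>fst P w\<^esub> Some f \<or> None \<succ>\<^bsub>snd P f\<^esub> Some w \<longrightarrow> match_prob g P w f = 0)"

definition is_utility :: "'a pref \<Rightarrow> ('a \<Rightarrow> real) \<Rightarrow> bool"
  where "is_utility r u \<longleftrightarrow> (\<forall>a b. u a > u b \<longleftrightarrow> a \<succ>\<^bsub>r\<^esub> b)"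

definition ordinal_strategy_proof_at :: "('w, 'f) mechanism \<Rightarrow> ('w, 'f) profile \<Rightarrow> bool"
  where "ordinal_strategy_proof_at g P \<longleftrightarrow>
    (\<forall>w u r. is_utility (fst P w) u \<longrightarrow>
      measure_pmf.expectation (g P) (\<lambda>\<mu>. u (worker_partner \<mu> w)) \<ge>
      measure_pmf.expectation (g (worker_report P w r)) (\<lambda>\<mu>. u (worker_partner \<mu> w))) \<and>
    (\<forall>f u r. is_utility (snd P f) u \<longrightarrow>
      measure_pmf.expectation (g P) (\<lambda>\<mu>. u (firm_partner \<mu> f)) \<ge>
      measure_pmf.expectation (g (firm_report P f r)) (\<lambda>\<mu>. u (firm_partner \<mu> f)))"

definition worker_gain ::
    "('w, 'f) mechanism \<Rightarrow> ('w, 'f) profile \<Rightarrow> 'w \<Rightarrow> 'f option pref \<Rightarrow> 'f \<Rightarrow> real"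
  where "worker_gain g P w r f = match_prob g (worker_report P w r) w f - match_prob g P w f"

definition firm_gain ::
    "('w, 'f) mechanism \<Rightarrow> ('w, 'f) profile \<Rightarrow> 'f \<Rightarrow> 'w option pref \<Rightarrow> 'w \<Rightarrow> real"
  where "firm_gain g P f r w = match_prob g (firm_report P f r) w f - match_prob g P w f"

definition Max0 :: "real set \<Rightarrow> real"
  where "Max0 A = (if A = {} then 0 else Max A)"

definition worker_regret ::
    "('w :: finite, 'f :: finite) mechanism \<Rightarrow> ('w, 'f) profile \<Rightarrow> 'w \<Rightarrow> real"
  where "worker_regret g P w =
    (MAX r. Max0 ((\<lambda>f'. \<Sum>f | Some f \<succeq>\<^bsub>fst P w\<^esub> Some f'. worker_gain g P w r f) `
      {f'. Some f' \<succ>\<^bsub>fst P w\<^esub> None}))"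

definition firm_regret ::
    "('w :: finite, 'f :: finite) mechanism \<Rightarrow> ('w, 'f) profile \<Rightarrow> 'f \<Rightarrow> real"
  where "firm_regret g P f =
    (MAX r. Max0 ((\<lambda>w'. \<Sum>w | Some w \<succeq>\<^bsub>snd P f\<^esub> Some w'. firm_gain g P f r w) `
      {w'. Some w' \<succ>\<^bsub>snd P f\<^esub> None}))"

text \<open>
  The normalisation is crosswise: the workers' regrets are divided by the number of firms and the
  firms' regrets by the number of workers.
\<close>

definition regret :: "('w :: finite, 'f :: finite) mechanism \<Rightarrow> ('w, 'f) profile \<Rightarrow> real"
  where "regret g P =
    1/2 * (1 / real CARD('f) * (\<Sum>w\<in>UNIV. worker_regret g P w) +
           1 / real CARD('w) * (\<Sum>f\<in>UNIV. firm_regret g P f))"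

definition RGT :: "('w :: finite, 'f :: finite) profile pmf \<Rightarrow> ('w, 'f) mechanism \<Rightarrow> real"
  where "RGT D g = measure_pmf.expectation D (regret g)"

end

theory Submission
  imports Defs
begin

text \<open>
  For a single agent, both sides express first-order stochastic dominance of the partner
  distribution under truth-telling over the one under a misreport. Dominance tests the upper
  contour sets of all outcomes; regret tests only those of acceptable partners, but individual
  rationality gives every larger upper contour set probability one under truth-telling. Reporting
  the truth shows that regrets are nonnegative, so the expected regret vanishes iff almost surely
  every single regret vanishes.
\<close>

section \<open>Stochastic dominance\<close>

lemma prefers_irrefl: "\<not> a \<succ>\<^bsub>r\<^esub> a"
  using pref_rel[of r] by (auto simp: prefers_def strict_linear_order_on_def irrefl_def)

lemma prefers_trans: "a \<succ>\<^bsub>r\<^esub> b \<Longrightarrow> b \<succ>\<^bsub>r\<^esub> c \<Longrightarrow> a \<succ>\<^bsub>r\<^esub> c"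
  using pref_rel[of r] by (auto simp: prefers_def strict_linear_order_on_def dest: transD)

lemma prefers_total: "a \<noteq> b \<Longrightarrow> a \<succ>\<^bsub>r\<^esub> b \<or> b \<succ>\<^bsub>r\<^esub> a"
  using pref_rel[of r] by (auto simp: prefers_def strict_linear_order_on_def total_on_def)

lemma utility_ge_iff: "is_utility r u \<Longrightarrow> u a \<ge> u b \<longleftrightarrow> a \<succeq>\<^bsub>r\<^esub> b"
  using prefers_total[of a b r] unfolding is_utility_def weakly_prefers_def
  by (metis less_le_not_le linorder_le_cases order_refl)

text \<open>Counting the outcomes ranked strictly below works: on a finite type, transitivity and
  irreflexivity make these lower sets strictly nested.\<close>

lemma utility_exists: "\<exists>u. is_utility (r :: 'a :: finite pref) u"
proof -
  define u where "u x = real (card {y. x \<succ>\<^bsub>r\<^esub> y})" for x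
  have *: "u b < u a" if "a \<succ>\<^bsub>r\<^esub> b" for a b
  proof -
    have "{y. b \<succ>\<^bsub>r\<^esub> y} \<subset> {y. a \<succ>\<^bsub>r\<^esub> y}"
      using that prefers_trans[OF that] prefers_irrefl[of b r] by auto
    then show ?thesis by (simp add: u_def psubset_card_mono)
  qed
  have "is_utility r u"
    unfolding is_utility_def using * prefers_total by (metis less_asym less_irrefl)
  then show ?thesis by blast
qed

text \<open>Abel summation, peeling off the lowest level of \<open>u\<close>.\<close>

lemma sum_mult_nonneg_of_upper_sums:
  fixes d u :: "'a \<Rightarrow> real"
  assumes "finite A" "\<And>x. x \<in> A \<Longrightarrow> u x \<ge> 0"
    and "\<And>a. a \<in> A \<Longrightarrow> (\<Sum>x | x \<in> A \<and> u x \<ge> u a. d x) \<ge> 0"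
  shows "(\<Sum>x\<in>A. d x * u x) \<ge> 0"
  using assms
proof (induction A arbitrary: u rule: finite_psubset_induct)
  case (psubset A)
  show ?case
  proof (cases "A = {}")
    case False
    define c where "c = Min (u ` A)"
    have c_in: "c \<in> u ` A" and c_le: "\<And>x. x \<in> A \<Longrightarrow> c \<le> u x"
      using psubset.hyps False by (auto simp: c_def)
    then obtain a where a: "a \<in> A" "u a = c" by blast
    \<comment> \<open>Write \<open>u\<close> as \<open>c + (u - c)\<close>. The constant part
      contributes \<open>c * sum d A\<close>, nonnegative because the upper set of the minimiser
      \<open>a\<close> is all of \<open>A\<close>; the rest vanishes on the lowest level, so it
      lives on the smaller set \<open>B\<close>.\<close>
    define B where "B = {x \<in> A. u x > c}"
    have "c \<ge> 0" using a psubset.prems(1) by auto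
    moreover have "{x \<in> A. u x \<ge> u a} = A" using c_le a by auto
    then have "sum d A \<ge> 0" using psubset.prems(2)[OF a(1)] by simp
    ultimately have total: "c * sum d A \<ge> 0" by simp
    have "(\<Sum>x\<in>B. d x * (u x - c)) \<ge> 0"
    proof (rule psubset.IH)
      show "B \<subset> A" using a by (auto simp: B_def)
      show "u x - c \<ge> 0" if "x \<in> B" for x using that by (auto simp: B_def)
      fix b assume b: "b \<in> B"
      \<comment> \<open>Above the level \<open>c\<close>, \<open>B\<close> and \<open>A\<close> have
        the same upper sets, so the hypothesis passes to the shifted function.\<close>
      then have "{x \<in> B. u x - c \<ge> u b - c} = {x \<in> A. u x \<ge> u b}"
        by (auto simp: B_def)
      then show "(\<Sum>x | x \<in> B \<and> u x - c \<ge> u b - c. d x) \<ge> 0"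
        using psubset.prems(2)[of b] b by (simp add: B_def)
    qed
    also have "(\<Sum>x\<in>B. d x * (u x - c)) = (\<Sum>x\<in>A. d x * (u x - c))"
      using psubset.hyps c_le by (intro sum.mono_neutral_left) (force simp: B_def)+
    also have "\<dots> = (\<Sum>x\<in>A. d x * u x) - c * sum d A"
      by (simp add: algebra_simps sum_subtractf sum_distrib_left)
    finally show ?thesis using total by simp
  qed simp
qed

text \<open>Let \<open>e\<close> tend to 0 from the right; \<open>t\<close> may have either sign.
  This serves to pass from strict utilities to indicators of upper sets, which are only weakly
  monotone.\<close>

lemma nonneg_if_perturbation_nonneg:
  fixes s t :: real
  assumes "\<And>e. e > 0 \<Longrightarrow> s + e * t \<ge> 0"
  shows "s \<ge> 0"
proof (rule tendsto_lowerbound)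
  show "((\<lambda>e. s + e * t) \<longlongrightarrow> s) (at_right 0)"
    by (auto intro!: tendsto_eq_intros)
  show "\<forall>\<^sub>F e in at_right 0. 0 \<le> s + e * t"
    using eventually_at_right_less[of "0 :: real"] by eventually_elim (rule assms)
qed simp

lemma expectation_pmf_finite:
  fixes u :: "'a :: finite \<Rightarrow> real"
  shows "measure_pmf.expectation p u = (\<Sum>x\<in>UNIV. pmf p x * u x)"
  by (subst integral_measure_pmf[of UNIV]) (auto)

lemma sum_pmf_UNIV: "(\<Sum>x\<in>UNIV. pmf (p :: 'a :: finite pmf) x) = 1"
  by (intro sum_pmf_eq_1) auto

text \<open>Indicators of upper contour sets are limits of utilities; conversely, up to a constant,
  every utility is a nonnegative combination of such indicators. Constants do not matter since
  \<open>p\<close> and \<open>q\<close> have equal mass.\<close>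

lemma expected_utility_le_iff_dominance:
  fixes p q :: "'a :: finite pmf"
  shows "(\<forall>u. is_utility r u \<longrightarrow> measure_pmf.expectation q u \<le> measure_pmf.expectation p u) \<longleftrightarrow>
    (\<forall>a. (\<Sum>x | x \<succeq>\<^bsub>r\<^esub> a. pmf q x) \<le> (\<Sum>x | x \<succeq>\<^bsub>r\<^esub> a. pmf p x))"
    (is "?util \<longleftrightarrow> ?dom")
proof -
  define d where "d x = pmf p x - pmf q x" for x
  have exp_diff: "measure_pmf.expectation p u - measure_pmf.expectation q u = (\<Sum>x\<in>UNIV. d x * u x)"
    for u by (simp add: expectation_pmf_finite d_def left_diff_distrib sum_subtractf)
  have upper_diff: "(\<Sum>x | x \<succeq>\<^bsub>r\<^esub> a. pmf p x) - (\<Sum>x | x \<succeq>\<^bsub>r\<^esub> a. pmf q x) = (\<Sum>x | x \<succeq>\<^bsub>r\<^esub> a. d x)"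
    for a by (simp add: d_def sum_subtractf)
  have d_total: "sum d UNIV = 0"
    by (simp add: d_def sum_subtractf sum_pmf_UNIV)
  show ?thesis
  proof
    assume ?util
    obtain v where v: "is_utility r v" using utility_exists by blast
    show ?dom
    proof
      fix a
      have "(\<Sum>x | x \<succeq>\<^bsub>r\<^esub> a. d x) + e * (\<Sum>x\<in>UNIV. d x * v x) \<ge> 0" if "e > 0" for e
      proof -
        \<comment> \<open>The indicator ties outcomes on the same side of the cut at
          \<open>a\<close>; adding a positive multiple of the utility \<open>v\<close> breaks these
          ties in the order \<open>r\<close>.\<close>
        define u where "u x = of_bool (x \<succeq>\<^bsub>r\<^esub> a) + e * v x" for x
        have mono: "u y < u x" if "x \<succ>\<^bsub>r\<^esub> y" for x y
        proof -
          have "y \<succeq>\<^bsub>r\<^esub> a \<Longrightarrow> x \<succeq>\<^bsub>r\<^esub> a"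
            using that prefers_trans[OF that] by (auto simp: weakly_prefers_def)
          moreover have "e * v y < e * v x"
            using v that \<open>e > 0\<close> by (simp add: is_utility_def)
          ultimately show ?thesis by (auto simp: u_def)
        qed
        have "is_utility r u"
          unfolding is_utility_def using mono prefers_total by (metis less_asym less_irrefl)
        then have "(\<Sum>x\<in>UNIV. d x * u x) \<ge> 0"
          using \<open>?util\<close> exp_diff[of u] by fastforce
        also have "(\<Sum>x\<in>UNIV. d x * u x) =
            (\<Sum>x\<in>UNIV. d x * of_bool (x \<succeq>\<^bsub>r\<^esub> a)) + e * (\<Sum>x\<in>UNIV. d x * v x)"
          by (simp add: u_def algebra_simps sum.distrib sum_distrib_left)
        also have "(\<Sum>x\<in>UNIV. d x * of_bool (x \<succeq>\<^bsub>r\<^esub> a)) = (\<Sum>x | x \<succeq>\<^bsub>r\<^esub> a. d x)"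
          by (intro sum.mono_neutral_cong_right) auto
        finally show ?thesis .
      qed
      then have "(\<Sum>x | x \<succeq>\<^bsub>r\<^esub> a. d x) \<ge> 0" by (rule nonneg_if_perturbation_nonneg)
      then show "(\<Sum>x | x \<succeq>\<^bsub>r\<^esub> a. pmf q x) \<le> (\<Sum>x | x \<succeq>\<^bsub>r\<^esub> a. pmf p x)"
        using upper_diff[of a] by simp
    qed
  next
    assume dom: ?dom
    show ?util
    proof (intro allI impI)
      fix u assume u: "is_utility r u"
      \<comment> \<open>The Abel summation lemma needs a nonnegative function. Subtracting the
        minimum is free because \<open>d\<close> sums to 0.\<close>
      define c where "c = Min (range u)"
      have "(\<Sum>x\<in>UNIV. d x * (u x - c)) \<ge> 0"
      proof (rule sum_mult_nonneg_of_upper_sums)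
        show "u x - c \<ge> 0" for x by (simp add: c_def)
        show "(\<Sum>x | x \<in> UNIV \<and> u x - c \<ge> u a - c. d x) \<ge> 0" for a
          using dom[rule_format, of a] upper_diff[of a] by (simp add: utility_ge_iff[OF u])
      qed simp
      also have "(\<Sum>x\<in>UNIV. d x * (u x - c)) = (\<Sum>x\<in>UNIV. d x * u x) - c * sum d UNIV"
        by (simp add: algebra_simps sum_subtractf sum_distrib_left)
      finally show "measure_pmf.expectation q u \<le> measure_pmf.expectation p u"
        using exp_diff[of u] d_total by simp
    qed
  qed
qed

text \<open>Being unmatched lies outside the upper contour set of an acceptable partner, so sums
  over outcomes become sums over partners, as in the definition of regret.\<close>

lemma sum_upper_Some:
  fixes h :: "'a :: finite option \<Rightarrow> real"
  assumes "Some a \<succ>\<^bsub>r\<^esub> None"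
  shows "(\<Sum>x | x \<succeq>\<^bsub>r\<^esub> Some a. h x) = (\<Sum>b | Some b \<succeq>\<^bsub>r\<^esub> Some a. h (Some b))"
proof -
  have "\<not> None \<succeq>\<^bsub>r\<^esub> Some a"
    using assms prefers_trans prefers_irrefl unfolding weakly_prefers_def by fastforce
  then have "{x. x \<succeq>\<^bsub>r\<^esub> Some a} = Some ` {b. Some b \<succeq>\<^bsub>r\<^esub> Some a}"
    by (auto simp: image_iff) (metis not_None_eq)
  then show ?thesis by (simp add: sum.reindex)
qed

text \<open>The hypothesis concerns \<open>p\<close> alone, the law under truth-telling: a misreport
  can lead to partners that are unacceptable under the true order \<open>r\<close>.\<close>

lemma dominance_iff_acceptable:
  fixes p q :: "'a :: finite option pmf"
  assumes ir: "\<And>a. None \<succ>\<^bsub>r\<^esub> Some a \<Longrightarrow> pmf p (Some a) = 0"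
  shows "(\<forall>a. (\<Sum>x | x \<succeq>\<^bsub>r\<^esub> a. pmf q x) \<le> (\<Sum>x | x \<succeq>\<^bsub>r\<^esub> a. pmf p x)) \<longleftrightarrow>
    (\<forall>a. Some a \<succ>\<^bsub>r\<^esub> None \<longrightarrow>
      (\<Sum>b | Some b \<succeq>\<^bsub>r\<^esub> Some a. pmf q (Some b) - pmf p (Some b)) \<le> 0)"
    (is "?dom \<longleftrightarrow> ?acc")
proof
  assume ?dom
  then show ?acc
    by (simp add: sum_subtractf flip: sum_upper_Some)
next
  assume acc: ?acc
  show ?dom
  proof
    fix a
    show "(\<Sum>x | x \<succeq>\<^bsub>r\<^esub> a. pmf q x) \<le> (\<Sum>x | x \<succeq>\<^bsub>r\<^esub> a. pmf p x)"
    proof (cases "a \<succ>\<^bsub>r\<^esub> None")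
      case True
      then obtain b where b: "a = Some b" by (cases a) (auto simp: prefers_irrefl)
      show ?thesis
        using acc True by (simp add: b sum_subtractf sum_upper_Some)
    next
      case False
      \<comment> \<open>Here \<open>a\<close> is \<open>None\<close> or ranked below it, so whatever
        misses the upper contour set of \<open>a\<close> is strictly worse than being unmatched and
        has \<open>p\<close>-probability 0.\<close>
      then have below: "None \<succ>\<^bsub>r\<^esub> x" if "\<not> x \<succeq>\<^bsub>r\<^esub> a" for x
        using that prefers_total[of a x r] prefers_total[of a None r] prefers_trans
        unfolding weakly_prefers_def by metis
      have "pmf p x = 0" if "\<not> x \<succeq>\<^bsub>r\<^esub> a" for x
        using below[OF that] ir by (cases x) (auto simp: prefers_irrefl)
      then have "(\<Sum>x | x \<succeq>\<^bsub>r\<^esub> a. pmf p x) = (\<Sum>x\<in>UNIV. pmf p x)"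
        by (intro sum.mono_neutral_left) auto
      moreover have "(\<Sum>x | x \<succeq>\<^bsub>r\<^esub> a. pmf q x) \<le> (\<Sum>x\<in>UNIV. pmf q x)"
        by (intro sum_mono2) auto
      ultimately show ?thesis by (simp add: sum_pmf_UNIV)
    qed
  qed
qed

section \<open>Regret of a single agent\<close>

lemma Max0_le_0_iff: "finite A \<Longrightarrow> Max0 A \<le> 0 \<longleftrightarrow> (\<forall>x\<in>A. x \<le> 0)"
  by (simp add: Max0_def)

text \<open>Here \<open>t\<close> stands for the truthful report, \<open>G r a\<close> for the
  cumulated gain of report \<open>r\<close> down to partner \<open>a\<close>. Truth-telling bounds
  the maximum below by 0, so it vanishes exactly when no gain is positive.\<close>

lemma Max_Max0_eq_0_iff:
  fixes G :: "'r :: finite \<Rightarrow> 'a :: finite \<Rightarrow> real"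
  assumes truth: "\<And>a. G t a = 0"
  shows "(MAX r. Max0 (G r ` A)) \<ge> 0"
    and "(MAX r. Max0 (G r ` A)) = 0 \<longleftrightarrow> (\<forall>r. \<forall>a\<in>A. G r a \<le> 0)"
proof -
  have "G t ` A \<subseteq> {0}" using truth by auto
  \<comment> \<open>With no acceptable partner the image is empty and the default value of
    \<open>Max0\<close> gives 0.\<close>
  then have "Max0 (G t ` A) = 0" by (auto simp: Max0_def subset_singleton_iff)
  then show nonneg: "(MAX r. Max0 (G r ` A)) \<ge> 0"
    by (metis Max_ge finite finite_imageI rangeI)
  have "(MAX r. Max0 (G r ` A)) \<le> 0 \<longleftrightarrow> (\<forall>r. \<forall>a\<in>A. G r a \<le> 0)"
    by (simp add: Max0_le_0_iff)
  moreover have "x = 0 \<longleftrightarrow> x \<le> 0" if "x \<ge> 0" for x :: real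
    using that by linarith
  ultimately show "(MAX r. Max0 (G r ` A)) = 0 \<longleftrightarrow> (\<forall>r. \<forall>a\<in>A. G r a \<le> 0)"
    using nonneg by blast
qed

lemma worker_partner_eq_Some_iff: "worker_partner \<mu> w = Some f \<longleftrightarrow> (w, f) \<in> pairs \<mu>"
  unfolding worker_partner_def by (auto intro: theI dest: matched_firm_unique)

lemma firm_partner_eq_Some_iff: "firm_partner \<mu> f = Some w \<longleftrightarrow> (w, f) \<in> pairs \<mu>"
  unfolding firm_partner_def by (auto intro: theI dest: matched_worker_unique)

text \<open>Pushing the random matching forward to one agent's partner gives a law on the option
  type, to which the dominance lemmas apply.\<close>

lemma pmf_worker_partner: "pmf (map_pmf (\<lambda>\<mu>. worker_partner \<mu> w) (g P)) (Some f) = match_prob g P w f"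
  by (simp add: pmf_map match_prob_def vimage_def worker_partner_eq_Some_iff)

lemma pmf_firm_partner: "pmf (map_pmf (\<lambda>\<mu>. firm_partner \<mu> f) (g P)) (Some w) = match_prob g P w f"
  by (simp add: pmf_map match_prob_def vimage_def firm_partner_eq_Some_iff)

lemma worker_regret_nonneg: "worker_regret g P w \<ge> 0"
  unfolding worker_regret_def
  by (rule Max_Max0_eq_0_iff(1)[of _ "fst P w"]) (simp add: worker_gain_def worker_report_def)

lemma firm_regret_nonneg: "firm_regret g P f \<ge> 0"
  unfolding firm_regret_def
  by (rule Max_Max0_eq_0_iff(1)[of _ "snd P f"]) (simp add: firm_gain_def firm_report_def)

lemma worker_regret_eq_0_iff:
  assumes "individually_rational g"
  shows "worker_regret g P w = 0 \<longleftrightarrow>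
    (\<forall>u r. is_utility (fst P w) u \<longrightarrow>
      measure_pmf.expectation (g (worker_report P w r)) (\<lambda>\<mu>. u (worker_partner \<mu> w)) \<le>
      measure_pmf.expectation (g P) (\<lambda>\<mu>. u (worker_partner \<mu> w)))"
proof -
  let ?p = "\<lambda>Q. map_pmf (\<lambda>\<mu>. worker_partner \<mu> w) (g Q)"
  have "worker_regret g P w = 0 \<longleftrightarrow> (\<forall>r f'. Some f' \<succ>\<^bsub>fst P w\<^esub> None \<longrightarrow>
      (\<Sum>f | Some f \<succeq>\<^bsub>fst P w\<^esub> Some f'. worker_gain g P w r f) \<le> 0)"
    unfolding worker_regret_def
    by (subst Max_Max0_eq_0_iff(2)[of _ "fst P w"]) (auto simp: worker_gain_def worker_report_def)
  also have "\<dots> \<longleftrightarrow> (\<forall>r u. is_utility (fst P w) u \<longrightarrow>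
      measure_pmf.expectation (?p (worker_report P w r)) u \<le> measure_pmf.expectation (?p P) u)"
  proof -
    \<comment> \<open>At \<open>P\<close> the worker reports the true order, so individual
      rationality excludes truly unacceptable firms.\<close>
    have "pmf (?p P) (Some f) = 0" if "None \<succ>\<^bsub>fst P w\<^esub> Some f" for f
      using assms that unfolding individually_rational_def pmf_worker_partner by blast
    \<comment> \<open>Only \<open>p\<close> is fixed, as the truthful law; \<open>q\<close> stays
      open, so that the equivalence rewrites the claim for every report \<open>r\<close>.\<close>
    from trans[OF expected_utility_le_iff_dominance
        dominance_iff_acceptable[where r = "fst P w" and p = "?p P", OF this]]
    show ?thesis by (simp only: pmf_worker_partner worker_gain_def)
  qed
  finally show ?thesis by auto
qed

lemma firm_regret_eq_0_iff:
  assumes "individually_rational g"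
  shows "firm_regret g P f = 0 \<longleftrightarrow>
    (\<forall>u r. is_utility (snd P f) u \<longrightarrow>
      measure_pmf.expectation (g (firm_report P f r)) (\<lambda>\<mu>. u (firm_partner \<mu> f)) \<le>
      measure_pmf.expectation (g P) (\<lambda>\<mu>. u (firm_partner \<mu> f)))"
proof -
  let ?p = "\<lambda>Q. map_pmf (\<lambda>\<mu>. firm_partner \<mu> f) (g Q)"
  have "firm_regret g P f = 0 \<longleftrightarrow> (\<forall>r w'. Some w' \<succ>\<^bsub>snd P f\<^esub> None \<longrightarrow>
      (\<Sum>w | Some w \<succeq>\<^bsub>snd P f\<^esub> Some w'. firm_gain g P f r w) \<le> 0)"
    unfolding firm_regret_def
    by (subst Max_Max0_eq_0_iff(2)[of _ "snd P f"]) (auto simp: firm_gain_def firm_report_def)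
  also have "\<dots> \<longleftrightarrow> (\<forall>r u. is_utility (snd P f) u \<longrightarrow>
      measure_pmf.expectation (?p (firm_report P f r)) u \<le> measure_pmf.expectation (?p P) u)"
  proof -
    have "pmf (?p P) (Some w) = 0" if "None \<succ>\<^bsub>snd P f\<^esub> Some w" for w
      using assms that unfolding individually_rational_def pmf_firm_partner by blast
    from trans[OF expected_utility_le_iff_dominance
        dominance_iff_acceptable[where r = "snd P f" and p = "?p P", OF this]]
    show ?thesis by (simp only: pmf_firm_partner firm_gain_def)
  qed
  finally show ?thesis by auto
qed

section \<open>Expected regret\<close>

lemma regret_nonneg: "regret g P \<ge> 0"
  by (simp add: regret_def sum_nonneg worker_regret_nonneg firm_regret_nonneg)

lemma regret_eq_0_iff:
  assumes "individually_rational g"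
  shows "regret g P = 0 \<longleftrightarrow> ordinal_strategy_proof_at g P"
proof -
  have "regret g P = 0 \<longleftrightarrow> (\<forall>w. worker_regret g P w = 0) \<and> (\<forall>f. firm_regret g P f = 0)"
    \<comment> \<open>The normalising weights are positive and all single regrets nonnegative, so
      nothing can cancel.\<close>
    by (simp add: regret_def add_nonneg_eq_0_iff sum_nonneg sum_nonneg_eq_0_iff
        worker_regret_nonneg firm_regret_nonneg)
  then show ?thesis
    by (simp add: worker_regret_eq_0_iff[OF assms] firm_regret_eq_0_iff[OF assms]
        ordinal_strategy_proof_at_def)
qed

theorem theorem15:
  fixes g :: "'p \<Rightarrow> ('w :: finite, 'f :: finite) mechanism"
    and \<theta> :: 'p
    and D :: "('w, 'f) profile pmf"
  assumes "individually_rational (g \<theta>)"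
  shows "(AE P in measure_pmf D. ordinal_strategy_proof_at (g \<theta>) P) \<longleftrightarrow> RGT D (g \<theta>) = 0"
proof -
  have "RGT D (g \<theta>) = 0 \<longleftrightarrow> (AE P in measure_pmf D. regret (g \<theta>) P = 0)"
    unfolding RGT_def
    \<comment> \<open>Profiles form a finite type, hence the regret is integrable; a nonnegative
      integrable function has integral 0 iff it is 0 almost surely.\<close>
    by (intro integral_nonneg_eq_0_iff_AE integrable_measure_pmf_finite)
      (auto simp: regret_nonneg intro: finite_subset[OF subset_UNIV])
  then show ?thesis
    by (simp add: regret_eq_0_iff[OF assms])
qed

end
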